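(* Let $k\ge1$, $n=2k+1$, and let $c$ be the lexical edge coloring of $M_k$ (and of $M_k/\pi$) described in the context. Then: (1) in $M_k/\pi$, every vertex is incident to exactly one edge of each color $0,1,\dots,k$, so the color classes form a $1$-factorization of $M_k/\pi$; (2) likewise, in $M_k$ every vertex is incident to exactly one edge of each color, so the coloring is a (covering) $1$-factorization of $M_k$; (3) the coloring is compatible with $\aleph$: for every $A\in L_k$ and every $i\notin A$, the edge $\{\aleph(A\cup\{i\}),\aleph(A)\}=\{\aleph(A\cup\{i\}),\aleph(A\cup\{i\})\cup\{n-1-i\}\}$ receives the same color as the edge $\{A,A\cup\{i\}\}$; in particular both edges of every skew specular pair of $M_k/\pi$ have the same color, so the $1$-factorization of $M_k/\pi$ collapses to a well-defined edge coloring (quotient $1$-factorization) of the reduced graph $R_k$.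
   Context: Let $k\ge1$, $n=2k+1$, indices taken mod $n$. Vertices of the $n$-cube are subsets $A\subseteq\{0,\dots,n-1\}$, identified with binary strings $b_0\dots b_{n-1}$; $L_j$ is the set of $j$-subsets. $M_k$ is the bipartite graph on $L_k\cup L_{k+1}$ with $A\sim A'$ iff $A\subset A'$. $\pi$ identifies sets that are cyclic translates of each other mod $n$; $M_k/\pi$ is the quotient multigraph whose edges are the translation orbits of edges of $M_k$. $\aleph(b_0\dots b_{n-1})=\bar b_{n-1}\dots\bar b_0$ (complement and reverse), a bijection $L_k\to L_{k+1}$ whose inverse is given by the same formula; it induces $\aleph_\pi:L_k/\pi\to L_{k+1}/\pi$. An edge of $M_k/\pi$ joining $u\in L_k/\pi$ and $w\in L_{k+1}/\pi$ is skew if $w\neq\aleph_\pi(u)$; a skew specular pair is a pair consisting of an edge $\{A,A\cup\{i\}\}$ (up to translation) and the edge $\{\aleph(A\cup\{i\}),\aleph(A)\}$ (up to translation). The reduced graph $R_k$ has vertex set $L_k/\pi$ (each $u$ standing for the pair $(u,\aleph_\pi(u))$), one edge per skew specular pair, and one loop at $u$ per horizontal edge between $u$ and $\aleph_\pi(u)$. Lexical coloring: for $A\in L_k$ and $i\notin A$, let $b_t=1$ iff $t+i\in A$ (so $b_0=0$ and $b_1\dots b_{2k}$ has $k$ ones and $k$ zeros). Read $b_1,\dots,b_{2k}$ as a lattice path from $(0,0)$ to $(k,k)$, a $0$ being a step $(1,0)$ and a $1$ a step $(0,1)$. The color of the edge $\{A,A\cup\{i\}\}$ is the number of steps $(x,y)\to(x+1,y)$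 of this path with $y\le x$ (horizontal steps below the diagonal); it lies in $\{0,\dots,k\}$ and is invariant under translation, hence also colors the edges of $M_k/\pi$. *)

theory Defs
  imports Main "HOL-Library.Disjoint_Sets"
begin

section \<open>Undirected multigraphs and 1-factorizations\<close>

text \<open>\<open>ends G e\<close> is the set of endpoints of \<open>e\<close>, a singleton if \<open>e\<close> is a loop. A loop
  belongs to a 1-factor as an edge that covers its only endpoint once.\<close>

record ('v, 'e) multigraph =
  verts :: "'v set"
  edges :: "'e set"
  ends :: "'e \<Rightarrow> 'v set"

definition one_factor :: "('v, 'e) multigraph \<Rightarrow> 'e set \<Rightarrow> bool" where
  "one_factor G F \<longleftrightarrow> F \<subseteq> edges G \<and> (\<forall>v \<in> verts G. \<exists>!e. e \<in> F \<and> v \<in> ends G e)"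

definition one_factorization :: "('v, 'e) multigraph \<Rightarrow> 'e set set \<Rightarrow> bool" where
  "one_factorization G \<F> \<longleftrightarrow> partition_on (edges G) \<F> \<and> (\<forall>F \<in> \<F>. one_factor G F)"

definition color_class :: "('v, 'e) multigraph \<Rightarrow> ('e \<Rightarrow> nat) \<Rightarrow> nat \<Rightarrow> 'e set" where
  "color_class G c j = {e \<in> edges G. c e = j}"

section \<open>The middle-levels graph\<close>

definition level :: "nat \<Rightarrow> nat \<Rightarrow> nat set set" where
  "level n j = {A. A \<subseteq> {..<n} \<and> card A = j}"

definition middle_graph :: "nat \<Rightarrow> (nat set, nat set set) multigraph" where
  "middle_graph k = (let n = 2 * k + 1 in
     \<lparr>verts = level n k \<union> level n (k + 1),
      edges = {{A, B} | A B. A \<in> level n k \<and> B \<in> level n (k + 1) \<and> A \<subset> B},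
      ends = (\<lambda>e. e)\<rparr>)"

section \<open>The quotient by cyclic translation\<close>

definition translate :: "nat \<Rightarrow> nat \<Rightarrow> nat set \<Rightarrow> nat set" where
  "translate n s A = (\<lambda>j. (j + s) mod n) ` A"

definition vertex_orbit :: "nat \<Rightarrow> nat set \<Rightarrow> nat set set" where
  "vertex_orbit n A = range (\<lambda>s. translate n s A)"

definition edge_orbit :: "nat \<Rightarrow> nat set set \<Rightarrow> nat set set set" where
  "edge_orbit n e = range (\<lambda>s. translate n s ` e)"

definition level_quotient :: "nat \<Rightarrow> nat \<Rightarrow> nat set set set" where
  "level_quotient n j = vertex_orbit n ` level n j"

definition quotient_graph :: "nat \<Rightarrow> (nat set set, nat set set set) multigraph" where
  "quotient_graph k = (let n = 2 * k + 1 in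
     \<lparr>verts = level_quotient n k \<union> level_quotient n (k + 1),
      edges = edge_orbit n ` edges (middle_graph k),
      ends = (\<lambda>E. vertex_orbit n ` (\<Union>E))\<rparr>)"

section \<open>Complement and reversal\<close>

definition aleph :: "nat \<Rightarrow> nat set \<Rightarrow> nat set" where
  "aleph n A = {j. j < n \<and> n - 1 - j \<notin> A}"

definition aleph_orbit :: "nat \<Rightarrow> nat set set \<Rightarrow> nat set set" where
  "aleph_orbit n u = aleph n ` u"

section \<open>The reduced graph\<close>

definition skew_edges :: "nat \<Rightarrow> nat set set set set" where
  "skew_edges k = (let n = 2 * k + 1 in
     {E \<in> edges (quotient_graph k).
        \<exists>u \<in> level_quotient n k. \<exists>w \<in> level_quotient n (k + 1).
          ends (quotient_graph k) E = {u, w} \<and> w \<noteq> aleph_orbit n u})"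

definition horizontal_edges :: "nat \<Rightarrow> nat set set set set" where
  "horizontal_edges k = (let n = 2 * k + 1 in
     {E \<in> edges (quotient_graph k).
        \<exists>u \<in> level_quotient n k. ends (quotient_graph k) E = {u, aleph_orbit n u}})"

definition skew_specular_pairs :: "nat \<Rightarrow> nat set set set set set" where
  "skew_specular_pairs k = (let n = 2 * k + 1 in
     {{edge_orbit n {A, insert i A}, edge_orbit n {aleph n (insert i A), aleph n A}} | A i.
        A \<in> level n k \<and> i \<in> {..<n} - A \<and> edge_orbit n {A, insert i A} \<in> skew_edges k})"

datatype 'e reduced_edge = Skew_Pair "'e set" | Horizontal_Loop 'e

fun underlying :: "'e reduced_edge \<Rightarrow> 'e set" where
  "underlying (Skew_Pair P) = P"
| "underlying (Horizontal_Loop E) = {E}"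

text \<open>A vertex \<open>u\<close> of the reduced graph stands for the two vertices \<open>u\<close> and
  \<open>aleph_orbit n u\<close> of the quotient graph, so it is an endpoint of a reduced edge as soon as
  one of the two is an endpoint of an underlying edge.\<close>

definition reduced_graph :: "nat \<Rightarrow> (nat set set, nat set set set reduced_edge) multigraph" where
  "reduced_graph k = (let n = 2 * k + 1 in
     \<lparr>verts = level_quotient n k,
      edges = Skew_Pair ` skew_specular_pairs k \<union> Horizontal_Loop ` horizontal_edges k,
      ends = (\<lambda>r. {u \<in> level_quotient n k. \<exists>E \<in> underlying r.
                     u \<in> ends (quotient_graph k) E \<or>
                     aleph_orbit n u \<in> ends (quotient_graph k) E})\<rparr>)"

section \<open>The lexical coloring\<close>

definition lex_bit :: "nat \<Rightarrow> nat set \<Rightarrow> nat \<Rightarrow> nat \<Rightarrow> bool" where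
  "lex_bit k A i t \<longleftrightarrow> (t + i) mod (2 * k + 1) \<in> A"

text \<open>The point from which the \<open>t\<close>-th step of the lattice path starts.\<close>

definition path_x :: "nat \<Rightarrow> nat set \<Rightarrow> nat \<Rightarrow> nat \<Rightarrow> nat" where
  "path_x k A i t = card {s \<in> {1..<t}. \<not> lex_bit k A i s}"

definition path_y :: "nat \<Rightarrow> nat set \<Rightarrow> nat \<Rightarrow> nat \<Rightarrow> nat" where
  "path_y k A i t = card {s \<in> {1..<t}. lex_bit k A i s}"

definition lex_color :: "nat \<Rightarrow> nat set \<Rightarrow> nat \<Rightarrow> nat" where
  "lex_color k A i =
     card {t \<in> {1..2 * k}. \<not> lex_bit k A i t \<and> path_y k A i t \<le> path_x k A i t}"

definition edge_color :: "nat \<Rightarrow> nat set set \<Rightarrow> nat" where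
  "edge_color k e = (THE c. \<exists>A \<in> level (2 * k + 1) k. \<exists>i \<in> {..<2 * k + 1} - A.
     e = {A, insert i A} \<and> c = lex_color k A i)"

lemma edge_color_eq:
  assumes "A \<in> level (2 * k + 1) k" "i \<in> {..<2 * k + 1} - A"
  shows "edge_color k {A, insert i A} = lex_color k A i"
  unfolding edge_color_def
proof (rule the_equality)
  show "\<exists>A' \<in> level (2 * k + 1) k. \<exists>i' \<in> {..<2 * k + 1} - A'.
      {A, insert i A} = {A', insert i' A'} \<and> lex_color k A i = lex_color k A' i'"
    using assms by (intro bexI[of _ A] bexI[of _ i]) simp_all
next
  fix c
  assume "\<exists>A' \<in> level (2 * k + 1) k. \<exists>i' \<in> {..<2 * k + 1} - A'.
      {A, insert i A} = {A', insert i' A'} \<and> c = lex_color k A' i'"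
  then obtain A' i' where *: "i' \<notin> A'" "{A, insert i A} = {A', insert i' A'}"
      "c = lex_color k A' i'"
    by auto
  have "A \<subseteq> A'" "A' \<subseteq> A"
    using *(2) by (metis doubleton_eq_iff subset_insertI subset_refl)+
  then have "A' = A"
    by simp
  moreover from this have "insert i A = insert i' A"
    using *(2) by (metis doubleton_eq_iff)
  then have "i = i'"
    using assms(2) *(1) \<open>A' = A\<close> by (metis DiffD2 insert_ident insertE insertI1)
  ultimately show "c = lex_color k A i"
    using *(3) by simp
qed

text \<open>The common color of the members of \<open>S\<close>; meaningful only if \<open>c\<close> is constant on the
  nonempty set \<open>S\<close>.\<close>

definition induced_color :: "('a \<Rightarrow> nat) \<Rightarrow> 'a set \<Rightarrow> nat" where
  "induced_color c S = (THE j. \<forall>e \<in> S. c e = j)"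

definition quotient_color :: "nat \<Rightarrow> nat set set set \<Rightarrow> nat" where
  "quotient_color k E = induced_color (edge_color k) E"

definition reduced_color :: "nat \<Rightarrow> nat set set set reduced_edge \<Rightarrow> nat" where
  "reduced_color k r = induced_color (quotient_color k) (underlying r)"

end

theory Submission
  imports Defs
begin

text \<open>Let \<open>h(p)\<close> be the number of zeros minus the number of ones of the \<open>n\<close>-periodic bit string of
  \<open>A\<close> before position \<open>p\<close>, so that \<open>h(p + n) = h(p) + 1\<close>, and put \<open>g(p) = n h(p) - p\<close>. Then \<open>g\<close> is
  \<open>n\<close>-periodic, and for a zero \<open>i\<close> and \<open>0 < t < n\<close> the lattice path based at \<open>i\<close> is weakly below
  the diagonal before its step \<open>t\<close> iff \<open>g(i) < g(i + t)\<close>. Hence the color of \<open>{A, A \<union> {i}}\<close> is the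
  rank of \<open>i\<close> among the \<open>k + 1\<close> zeros of \<open>A\<close> ordered by decreasing \<open>g\<close>, a bijection onto
  \<open>{0..k}\<close>. The upper level follows because \<open>aleph\<close> preserves colors.

  In the quotient, the edge of color \<open>j\<close> at an orbit lifts to the one at any of its
  members. A horizontal edge is fixed by \<open>aleph\<close>, as its image has the same ends and the same
  color; thus an edge of the reduced graph is an orbit of \<open>aleph\<close> on the edges of the quotient.\<close>

section \<open>Ranks in a finite set with an injective key\<close>

text \<open>A larger key means strictly fewer elements above it, so ranks are distinct. No element
  lies above itself, so every rank is below \<open>card S\<close>, and counting gives
  surjectivity.\<close>

lemma rank_bij_betw:
  fixes g :: "'a \<Rightarrow> 'b::linorder"
  assumes "finite S" and "inj_on g S"
  shows "bij_betw (\<lambda>x. card {y \<in> S. g x < g y}) S {..<card S}"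
proof -
  let ?r = "\<lambda>x. card {y \<in> S. g x < g y}"
  have less: "?r y < ?r x" if "x \<in> S" "y \<in> S" "g x < g y" for x y
    using that assms(1) by (intro psubset_card_mono) auto
  have inj: "inj_on ?r S"
  proof (rule inj_onI)
    fix x y assume "x \<in> S" "y \<in> S" "?r x = ?r y"
    then have "g x = g y"
      using less[of x y] less[of y x] by (metis less_irrefl neqE)
    then show "x = y"
      using assms(2) \<open>x \<in> S\<close> \<open>y \<in> S\<close> by (auto dest: inj_onD)
  qed
  have "?r ` S \<subseteq> {..<card S}"
    using assms(1) by (auto intro!: psubset_card_mono)
  then have "?r ` S = {..<card S}"
    using card_image[OF inj] by (intro card_subset_eq) auto
  with inj show ?thesis
    by (simp add: bij_betw_def)
qed

section \<open>The lexical color as a rank\<close>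

definition height :: "nat \<Rightarrow> nat set \<Rightarrow> nat \<Rightarrow> int" where
  "height n A p = (\<Sum>s<p. if s mod n \<in> A then - 1 else 1)"

text \<open>With \<open>g = slope_key n A\<close>, the subtraction of \<open>p\<close> makes \<open>g\<close> \<open>n\<close>-periodic, since the
  height grows by 1 per period, and injective on a period, since \<open>g p\<close> is congruent to \<open>-p\<close>
  modulo \<open>n\<close>.\<close>

definition slope_key :: "nat \<Rightarrow> nat set \<Rightarrow> nat \<Rightarrow> int" where
  "slope_key n A p = int n * height n A p - int p"

text \<open>One period contains \<open>k\<close> ones and \<open>k + 1\<close> zeros.\<close>

lemma height_period:
  assumes "A \<in> level n k" and "n = 2 * k + 1"
  shows "height n A n = 1"
proof -
  have A: "A \<subseteq> {..<n}" "card A = k"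
    using assms(1) by (auto simp: level_def)
  have "height n A n = (\<Sum>s\<in>{..<n}. if s \<in> A then - 1 else 1)"
    unfolding height_def by (intro sum.cong) auto
  also have "\<dots> = (\<Sum>s\<in>{..<n} \<inter> A. - 1) + (\<Sum>s\<in>{..<n} - A. 1)"
    by (simp add: sum.If_cases Diff_eq)
  also have "{..<n} \<inter> A = A"
    using A(1) by auto
  finally show ?thesis
    using A assms(2) by (simp add: card_Diff_subset finite_subset)
qed

lemma height_add_period:
  assumes "A \<in> level n k" and "n = 2 * k + 1"
  shows "height n A (p + n) = height n A p + 1"
proof (induction p)
  case 0
  show ?case using height_period[OF assms] by (simp add: height_def)
next
  case (Suc p)
  then show ?case
    by (simp add: height_def)
qed

lemma slope_key_mod:
  assumes "A \<in> level n k" and "n = 2 * k + 1"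
  shows "slope_key n A (p mod n) = slope_key n A p"
proof -
  have "slope_key n A (r + m * n) = slope_key n A r" for r m
  proof (induction m)
    case (Suc m)
    then show ?case
      using height_add_period[OF assms, of "r + m * n"]
      by (simp add: slope_key_def algebra_simps)
  qed simp
  from this[of "p mod n" "p div n"] show ?thesis
    by simp
qed

lemma inj_on_slope_key: "inj_on (slope_key n A) {..<n}"
proof (rule inj_onI)
  fix p q assume "p \<in> {..<n}" "q \<in> {..<n}" "slope_key n A p = slope_key n A q"
  then have "int p - int q = int n * (height n A p - height n A q)" and lt: "p < n" "q < n"
    by (auto simp: slope_key_def algebra_simps)
  then have "int n dvd int p - int q"
    by simp
  then have "int p mod int n = int q mod int n"
    by (simp add: mod_eq_dvd_iff)
  then show "p = q"
    using lt by simp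
qed

lemma card_filter_atLeastLessThan_Suc:
  assumes "1 \<le> t"
  shows "card {s \<in> {1..<Suc t}. P s} = card {s \<in> {1..<t}. P s} + of_bool (P t)"
proof -
  have "{s \<in> {1..<Suc t}. P s} = (if P t then insert t {s \<in> {1..<t}. P s} else {s \<in> {1..<t}. P s})"
    using assms by (auto simp: less_Suc_eq)
  then show ?thesis by simp
qed

text \<open>The steps before step \<open>t\<close> read the positions \<open>i + 1\<close>, ...,
  \<open>i + t - 1\<close>. The bit at \<open>i\<close> is not part of the path, hence the base
  point \<open>i + 1\<close>.\<close>

lemma path_diff_eq_height:
  assumes "1 \<le> t"
  shows "int (path_x k A i t) - int (path_y k A i t) =
    height (2 * k + 1) A (i + t) - height (2 * k + 1) A (i + 1)"
  using assms
proof (induction t rule: dec_induct)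
  case base
  show ?case by (simp add: path_x_def path_y_def)
next
  case (step t)
  then show ?case
    unfolding path_x_def path_y_def card_filter_atLeastLessThan_Suc[OF step(1)]
    by (auto simp: height_def lex_bit_def add.commute)
qed

lemma path_below_iff_slope_key:
  assumes "A \<in> level (2 * k + 1) k" "i < 2 * k + 1" "i \<notin> A" "t \<in> {1..2 * k}"
  shows "path_y k A i t \<le> path_x k A i t \<longleftrightarrow>
    slope_key (2 * k + 1) A i < slope_key (2 * k + 1) A ((t + i) mod (2 * k + 1))"
proof -
  let ?n = "2 * k + 1"
  let ?d = "height ?n A (i + t) - height ?n A i"
  \<comment> \<open>The bit at \<open>i\<close> is a zero, so moving the base point back from
    \<open>i + 1\<close> to \<open>i\<close> turns the condition 0 <= x - y into 1 <=
    \<open>?d\<close>.\<close>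
  have "height ?n A (i + 1) = height ?n A i + 1"
    using assms(2,3) by (simp add: height_def)
  then have "path_y k A i t \<le> path_x k A i t \<longleftrightarrow> 1 \<le> ?d"
    using path_diff_eq_height[of t k A i] assms(4) by auto
  \<comment> \<open>As 0 < t < n and \<open>?d\<close> is an integer, one unit of height, weighted
    by n, outweighs the \<open>t\<close> that \<open>slope_key\<close> subtracts.\<close>
  also have "\<dots> \<longleftrightarrow> int t < int ?n * ?d"
  proof
    assume "1 \<le> ?d"
    have "int t < int ?n * 1"
      using assms(4) by simp
    also have "\<dots> \<le> int ?n * ?d"
      using \<open>1 \<le> ?d\<close> by (rule mult_left_mono) simp
    finally show "int t < int ?n * ?d" .
  next
    assume "int t < int ?n * ?d"
    then have "0 < int ?n * ?d" by linarith
    then show "1 \<le> ?d" by (simp add: zero_less_mult_iff)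
  qed
  also have "\<dots> \<longleftrightarrow> slope_key ?n A i < slope_key ?n A (t + i)"
    unfolding slope_key_def right_diff_distrib of_nat_add add.commute[of t i] by linarith
  finally show ?thesis
    using slope_key_mod[OF assms(1) refl] by simp
qed

lemma bij_betw_add_mod: "bij_betw (\<lambda>j. (j + s) mod n) {..<n} {..<n::nat}"
proof -
  have "inj_on (\<lambda>j. (j + s) mod n) {..<n}"
  proof (rule inj_onI)
    fix i j assume ij: "i \<in> {..<n}" "j \<in> {..<n}" and "(i + s) mod n = (j + s) mod n"
    then have "(int i + int s) mod int n = (int j + int s) mod int n"
      by (simp flip: of_nat_add of_nat_mod)
    from mod_diff_cong[OF this refl, of "int s"] show "i = j"
      using ij by simp
  qed
  then show ?thesis
    unfolding bij_betw_def by (intro conjI endo_inj_surj) auto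
qed

text \<open>The map from \<open>t\<close> to \<open>(t + i) mod n\<close> carries the counted
  horizontal steps to the zeros of \<open>A\<close> whose key exceeds that of
  \<open>i\<close>.\<close>

lemma lex_color_eq_rank:
  assumes "A \<in> level (2 * k + 1) k" "i \<in> {..<2 * k + 1} - A"
  shows "lex_color k A i = card {p \<in> {..<2 * k + 1} - A.
    slope_key (2 * k + 1) A i < slope_key (2 * k + 1) A p}"
proof -
  let ?n = "2 * k + 1"
  let ?f = "\<lambda>t. (t + i) mod ?n"
  let ?g = "slope_key ?n A"
  let ?T = "{t \<in> {..<?n}. ?f t \<notin> A \<and> ?g i < ?g (?f t)}"
  \<comment> \<open>The range of \<open>t\<close> may be extended to a full period:
    \<open>t = 0\<close> leads back to \<open>i\<close>, whose key is not larger than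
    itself.\<close>
  have "t \<noteq> 0" if "t \<in> ?T" for t
    using that assms(2) by (intro notI) auto
  then have "{t \<in> {1..2 * k}. \<not> lex_bit k A i t \<and> path_y k A i t \<le> path_x k A i t} = ?T"
    using path_below_iff_slope_key[OF assms(1)] assms(2) unfolding lex_bit_def by fastforce
  then have "lex_color k A i = card ?T"
    by (simp add: lex_color_def)
  also have "\<dots> = card (?f ` ?T)"
    by (intro card_image[symmetric] inj_on_subset[OF bij_betw_imp_inj_on[OF bij_betw_add_mod]]) auto
  also have "?f ` ?T = {p \<in> ?f ` {..<?n} - A. ?g i < ?g p}"
    by auto
  also have "?f ` {..<?n} = {..<?n}"
    by (rule bij_betw_imp_surj_on[OF bij_betw_add_mod])
  finally show ?thesis .
qed

text \<open>The \<open>k + 1\<close> zeros of \<open>A\<close> have distinct keys, so their ranks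
  exhaust 0, ..., k.\<close>

lemma bij_betw_lex_color:
  assumes "A \<in> level (2 * k + 1) k"
  shows "bij_betw (lex_color k A) ({..<2 * k + 1} - A) {0..k}"
proof -
  let ?S = "{..<2 * k + 1} - A"
  have "card ?S = k + 1"
    using assms by (auto simp: level_def card_Diff_subset finite_subset)
  then have *: "{..<card ?S} = {0..k}"
    by auto
  have "inj_on (slope_key (2 * k + 1) A) ?S"
    by (rule inj_on_subset[OF inj_on_slope_key]) auto
  from rank_bij_betw[OF _ this] show ?thesis
    unfolding * by (rule bij_betw_cong[THEN iffD1, rotated])
      (auto simp: lex_color_eq_rank[OF assms])
qed

section \<open>Horizontal and vertical steps below the diagonal\<close>

text \<open>The truncated difference X - Y, the positive part of the distance below the diagonal,
  grows by one at each horizontal step starting with Y <= X, drops by one at each vertical step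
  starting with Y < X, and is unchanged by all other steps.\<close>

lemma horizontal_steps_below_eq:
  fixes b :: "nat \<Rightarrow> bool"
  defines "X t \<equiv> card {s \<in> {1..<t}. \<not> b s}" and "Y t \<equiv> card {s \<in> {1..<t}. b s}"
  shows "card {t \<in> {1..m}. \<not> b t \<and> Y t \<le> X t} =
    card {t \<in> {1..m}. b t \<and> Y t < X t} + (X (Suc m) - Y (Suc m))"
proof (induction m)
  case (Suc m)
  have C: "card {t \<in> {1..Suc m}. P t} = card {t \<in> {1..m}. P t} + of_bool (P (Suc m))" for P
    using card_filter_atLeastLessThan_Suc[of "Suc m" P]
    by (simp add: atLeastLessThanSuc_atLeastAtMost)
  have XY: "X (Suc (Suc m)) = X (Suc m) + of_bool (\<not> b (Suc m))"
    "Y (Suc (Suc m)) = Y (Suc m) + of_bool (b (Suc m))"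
    unfolding X_def Y_def by (rule card_filter_atLeastLessThan_Suc, simp)+
  show ?case
    unfolding C XY using Suc by auto
qed (simp add: X_def Y_def)

section \<open>Translation and reversal\<close>

lemma translate_mem_iff:
  assumes "A \<subseteq> {..<n}" and "j < n"
  shows "(j + s) mod n \<in> translate n s A \<longleftrightarrow> j \<in> A"
  using inj_on_image_mem_iff[OF bij_betw_imp_inj_on[OF bij_betw_add_mod, of s n], of j A] assms
  by (simp add: translate_def)

lemma translate_subset: "A \<subseteq> {..<n} \<Longrightarrow> translate n s A \<subseteq> {..<n}"
  using bij_betw_imp_surj_on[OF bij_betw_add_mod, of s n] unfolding translate_def by blast

lemma translate_level: "A \<in> level n j \<Longrightarrow> translate n s A \<in> level n j"
  using translate_subset[of A n s] inj_on_subset[OF bij_betw_imp_inj_on[OF bij_betw_add_mod]]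
  by (auto simp: level_def translate_def card_image)

lemma translate_translate: "translate n s (translate n t A) = translate n (t + s) A"
  by (simp add: translate_def image_image mod_simps add.assoc)

lemma translate_mult_self: "A \<subseteq> {..<n} \<Longrightarrow> translate n (n * s) A = A"
  by (force simp: translate_def)

text \<open>The factor \<open>(n - 1) * s\<close> plays the role of -s modulo n, because the shifts
  are natural numbers and s + (n - 1) s = n s.\<close>

lemma translate_inverse:
  assumes "A \<subseteq> {..<n}"
  shows "translate n ((n - 1) * s) (translate n s A) = A"
proof -
  \<comment> \<open>For \<open>n = 0\<close> the equation can fail, but then \<open>A\<close> is
    empty.\<close>
  have "n = 0 \<or> s + (n - 1) * s = n * s"
    by (cases n) auto
  then show ?thesis
    using assms translate_mult_self[OF assms, of s]
    by (auto simp: translate_translate) (auto simp: translate_def)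
qed

lemma translate_insert: "translate n s (insert i A) = insert ((i + s) mod n) (translate n s A)"
  by (simp add: translate_def)

lemma aleph_subset: "aleph n A \<subseteq> {..<n}"
  by (auto simp: aleph_def)

lemma aleph_aleph: "A \<subseteq> {..<n} \<Longrightarrow> aleph n (aleph n A) = A"
  by (force simp: aleph_def)

text \<open>\<open>aleph n A\<close> is the complement of the mirror image of \<open>A\<close>. The
  truncated subtraction in the mirror map is injective on numbers below \<open>n\<close>.\<close>

lemma aleph_level:
  assumes "A \<in> level n j"
  shows "aleph n A \<in> level n (n - j)"
proof -
  have A: "A \<subseteq> {..<n}" "card A = j"
    using assms by (auto simp: level_def)
  have inj: "inj_on (\<lambda>j. n - 1 - j) A"
  proof (rule inj_onI)
    fix x y assume "x \<in> A" "y \<in> A" "n - 1 - x = n - 1 - y"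
    moreover from this have "x < n" "y < n"
      using A(1) by auto
    ultimately show "x = y"
      by linarith
  qed
  have "aleph n A = {..<n} - (\<lambda>j. n - 1 - j) ` A"
  proof -
    have "n - 1 - j \<in> A \<longleftrightarrow> j \<in> (\<lambda>j. n - 1 - j) ` A" if "j < n" for j
    proof
      assume "n - 1 - j \<in> A"
      moreover have "j = n - 1 - (n - 1 - j)"
        using that by simp
      ultimately show "j \<in> (\<lambda>j. n - 1 - j) ` A"
        by (rule rev_image_eqI)
    next
      assume "j \<in> (\<lambda>j. n - 1 - j) ` A"
      then obtain i where "i \<in> A" "j = n - 1 - i"
        by auto
      moreover have "i < n"
        using \<open>i \<in> A\<close> A(1) by auto
      ultimately show "n - 1 - j \<in> A"
        by simp
    qed
    then show ?thesis
      unfolding aleph_def by blast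
  qed
  moreover have "(\<lambda>j. n - 1 - j) ` A \<subseteq> {..<n}"
    using A(1) by auto
  ultimately have "card (aleph n A) = n - j"
    using A inj by (simp add: card_Diff_subset finite_subset card_image)
  then show ?thesis
    by (simp add: level_def aleph_subset)
qed

lemma aleph_eq_insert:
  "i < n \<Longrightarrow> i \<notin> A \<Longrightarrow> aleph n A = insert (n - 1 - i) (aleph n (insert i A))"
  by (auto simp: aleph_def)

text \<open>Reversal turns a shift by s into a shift by -s, and complementation commutes with
  shifts.\<close>

lemma aleph_translate:
  assumes "A \<subseteq> {..<n}"
  shows "aleph n (translate n s A) = translate n ((n - 1) * s) (aleph n A)"
proof -
  let ?T = "translate n s"
  \<comment> \<open>Shifting once more by \<open>s\<close> clears the negative shift, so that only
    memberships have to be compared; \<open>translate_inverse\<close> restores it at the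
    end.\<close>
  have "?T (aleph n (?T A)) = aleph n A"
  proof (rule set_eqI)
    fix y
    show "y \<in> ?T (aleph n (?T A)) \<longleftrightarrow> y \<in> aleph n A"
    proof (cases "y < n")
      case True
      then obtain x where x: "x < n" "y = (x + s) mod n"
        using bij_betw_imp_surj_on[OF bij_betw_add_mod, of s n] by blast
      \<comment> \<open>The mirror image of \<open>y\<close> shifted by \<open>s\<close> is the
        mirror image of \<open>x\<close>. The computation passes to integers, where subtraction is
        compatible with \<open>mod\<close>.\<close>
      have "(n - 1 - y + s) mod n = n - 1 - x"
      proof -
        have "int y = (int x + int s) mod int n"
          by (simp add: x(2) of_nat_mod)
        then have "int (n - 1 - y) + int s = int n - 1 + int s - (int x + int s) mod int n"
          using True by linarith
        then have "int ((n - 1 - y + s) mod n) = (int n - 1 + int s - (int x + int s) mod int n) mod int n"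
          by (simp only: of_nat_mod of_nat_add)
        also have "\<dots> = (int n - 1 - int x) mod int n"
          by (simp add: mod_diff_right_eq)
        also have "\<dots> = int (n - 1 - x)"
          using x by (simp add: of_nat_diff)
        finally show ?thesis by simp
      qed
      then have "n - 1 - x \<in> ?T A \<longleftrightarrow> n - 1 - y \<in> A"
        using translate_mem_iff[OF assms, of "n - 1 - y" s] True by simp
      then show ?thesis
        using x True translate_mem_iff[OF aleph_subset x(1), of s "?T A"]
        by (auto simp: aleph_def)
    next
      case False
      then show ?thesis
        using translate_subset[OF aleph_subset] aleph_subset by blast
    qed
  qed
  then show ?thesis
    using translate_inverse[OF aleph_subset, of n s "translate n s A"] by simp
qed

section \<open>Invariance of the lexical color\<close>

text \<open>Shifting \<open>A\<close> and \<open>i\<close> together leaves the string read from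
  \<open>i\<close> unchanged.\<close>

lemma lex_color_translate:
  assumes "A \<subseteq> {..<2 * k + 1}"
  shows "lex_color k (translate (2 * k + 1) s A) ((i + s) mod (2 * k + 1)) = lex_color k A i"
proof -
  have "lex_bit k (translate (2 * k + 1) s A) ((i + s) mod (2 * k + 1)) t = lex_bit k A i t" for t
    using translate_mem_iff[OF assms, of "(t + i) mod (2 * k + 1)" s]
    unfolding lex_bit_def by (simp add: mod_simps add.assoc)
  then show ?thesis
    by (simp add: lex_color_def path_x_def path_y_def)
qed

text \<open>The first \<open>t - 1\<close> places of the reversed string are the last
  \<open>t - 1\<close> places of the original one; together with the remaining initial segment they
  make up the whole string.\<close>

lemma card_filter_reflect:
  assumes "t \<in> {1..n}"
  shows "card {s \<in> {1..<t}. P (n - s)} + card {s \<in> {1..<Suc n - t}. P s} = card {s \<in> {1..<n}. P s}"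
proof -
  have "{s \<in> {Suc n - t..<n}. P s} = (\<lambda>s. n - s) ` {s \<in> {1..<t}. P (n - s)}"
  proof (intro equalityI subsetI)
    fix s assume s: "s \<in> {s \<in> {Suc n - t..<n}. P s}"
    then have "n - s \<in> {s \<in> {1..<t}. P (n - s)}"
      using assms by auto
    moreover have "s = n - (n - s)"
      using s by simp
    ultimately show "s \<in> (\<lambda>s. n - s) ` {s \<in> {1..<t}. P (n - s)}"
      by (rule rev_image_eqI)
  qed (use assms in auto)
  moreover have "inj_on (\<lambda>s. n - s) {s \<in> {1..<t}. P (n - s)}"
    using assms by (auto intro!: inj_onI)
  ultimately have "card {s \<in> {1..<t}. P (n - s)} = card {s \<in> {Suc n - t..<n}. P s}"
    by (simp add: card_image)
  moreover have split: "{s \<in> {1..<n}. P s} = {s \<in> {Suc n - t..<n}. P s} \<union> {s \<in> {1..<Suc n - t}. P s}"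
    using assms by auto
  have "card {s \<in> {1..<n}. P s} = card {s \<in> {Suc n - t..<n}. P s} + card {s \<in> {1..<Suc n - t}. P s}"
    unfolding split by (rule card_Un_disjoint) auto
  ultimately show ?thesis
    by simp
qed

text \<open>Both bits concern the position congruent to i - t modulo n, once directly and once
  mirrored and complemented. Since 0 < t < n this position is not \<open>i\<close>, so inserting
  \<open>i\<close> does not affect it. The cases \<open>t \<le> i\<close> and \<open>t > i\<close>
  decide which of the two sums wraps around.\<close>

lemma lex_bit_aleph:
  assumes "i < 2 * k + 1" and "t \<in> {1..2 * k}"
  shows "lex_bit k (aleph (2 * k + 1) (insert i A)) (2 * k - i) t \<longleftrightarrow> \<not> lex_bit k A i (2 * k + 1 - t)"
proof (cases "t \<le> i")
  case True
  then have "(t + (2 * k - i)) mod (2 * k + 1) = 2 * k + t - i"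
    using assms by (simp add: mod_less)
  moreover have "(2 * k + 1 - t + i) mod (2 * k + 1) = i - t"
    using assms True by (simp add: mod_if)
  moreover have "2 * k - (2 * k + t - i) = i - t"
    using assms True by simp
  ultimately show ?thesis
    using assms True by (auto simp: lex_bit_def aleph_def)
next
  case False
  then have "(t + (2 * k - i)) mod (2 * k + 1) = t - 1 - i"
    using assms by (simp add: mod_if)
  moreover have "(2 * k + 1 - t + i) mod (2 * k + 1) = 2 * k + 1 - t + i"
    using assms False by (simp add: mod_less)
  moreover have "2 * k - (t - 1 - i) = 2 * k + 1 - t + i"
    using assms False by simp
  ultimately show ?thesis
    using assms False by (auto simp: lex_bit_def aleph_def)
qed

text \<open>A full period raises the height by 1, and the zero at \<open>i\<close>, which the path
  skips, already accounts for that.\<close>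

lemma path_ends_on_diagonal:
  assumes "A \<in> level (2 * k + 1) k" "i \<in> {..<2 * k + 1} - A"
  shows "path_x k A i (2 * k + 1) = path_y k A i (2 * k + 1)"
  using path_diff_eq_height[of "2 * k + 1" k A i] height_add_period[OF assms(1) refl, of i] assms(2)
  by (simp add: height_def)

text \<open>Passing to \<open>aleph\<close> reflects the path in the antidiagonal, which turns the horizontal steps
  below the diagonal into the vertical ones; a path ending on the diagonal has as many of
  either kind.\<close>

lemma lex_color_aleph:
  assumes "A \<in> level (2 * k + 1) k" "i \<in> {..<2 * k + 1} - A"
  shows "lex_color k (aleph (2 * k + 1) (insert i A)) (2 * k - i) = lex_color k A i"
proof -
  let ?n = "2 * k + 1"
  let ?A' = "aleph ?n (insert i A)" and ?i' = "2 * k - i"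
  define b where "b = lex_bit k A i"
  define b' where "b' = lex_bit k ?A' ?i'"
  define X where "X = path_x k A i"
  define Y where "Y = path_y k A i"
  define X' where "X' = path_x k ?A' ?i'"
  define Y' where "Y' = path_y k ?A' ?i'"
  have X: "X t = card {s \<in> {1..<t}. \<not> b s}" and Y: "Y t = card {s \<in> {1..<t}. b s}"
    and X': "X' t = card {s \<in> {1..<t}. \<not> b' s}" and Y': "Y' t = card {s \<in> {1..<t}. b' s}" for t
    unfolding X_def Y_def X'_def Y'_def b_def b'_def path_x_def path_y_def by (rule refl)+
  have b': "b' t \<longleftrightarrow> \<not> b (?n - t)" if "t \<in> {1..2 * k}" for t
    using lex_bit_aleph[OF _ that] assms(2) unfolding b_def b'_def by blast
  have diag: "X ?n = Y ?n"
    using path_ends_on_diagonal[OF assms] unfolding X_def Y_def .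
  \<comment> \<open>Before its step \<open>?n - s\<close> the new path has read exactly the original
    bits after step \<open>s\<close>, reversed and complemented. Its zeros are therefore the ones
    that the original path has not yet met after step \<open>s\<close>, and conversely.\<close>
  have X'_Y: "X' (?n - s) + Y (Suc s) = Y ?n" and Y'_X: "Y' (?n - s) + X (Suc s) = X ?n"
    if s: "s \<in> {1..2 * k}" for s
  proof -
    have eq: "{u \<in> {1..<?n - s}. \<not> b' u} = {u \<in> {1..<?n - s}. b (?n - u)}"
      "{u \<in> {1..<?n - s}. b' u} = {u \<in> {1..<?n - s}. \<not> b (?n - u)}"
      using b' by auto
    have t: "?n - s \<in> {1..?n}" "Suc ?n - (?n - s) = Suc s"
      using s by auto
    show "X' (?n - s) + Y (Suc s) = Y ?n" "Y' (?n - s) + X (Suc s) = X ?n"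
      using card_filter_reflect[OF t(1), of b] card_filter_reflect[OF t(1), of "\<lambda>s. \<not> b s"]
      unfolding X Y X' Y' eq t(2) by blast+
  qed
  \<comment> \<open>The start of the new step mirrors the end of step \<open>s\<close>. As step
    \<open>s\<close> is vertical, it raises Y by one, which makes the weak inequality strict at its
    start.\<close>
  have step: "Y' (?n - s) \<le> X' (?n - s) \<longleftrightarrow> Y s < X s" if s: "s \<in> {1..2 * k}" "b s" for s
  proof -
    have "1 \<le> s"
      using s(1) by simp
    then have "X (Suc s) = X s" "Y (Suc s) = Y s + 1"
      unfolding X Y card_filter_atLeastLessThan_Suc[OF \<open>1 \<le> s\<close>] using s(2) by simp_all
    then show ?thesis
      using X'_Y[OF s(1)] Y'_X[OF s(1)] diag by linarith
  qed
  let ?R = "{t \<in> {1..2 * k}. \<not> b' t \<and> Y' t \<le> X' t}" and ?V = "{s \<in> {1..2 * k}. b s \<and> Y s < X s}"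
  have "lex_color k ?A' ?i' = card ?R"
    unfolding lex_color_def b'_def X'_def Y'_def by (rule refl)
  also have "\<dots> = card ?V"
  proof (rule bij_betw_same_card, rule bij_betwI)
    show "(\<lambda>t. ?n - t) \<in> ?R \<rightarrow> ?V"
    proof
      fix t assume t: "t \<in> ?R"
      then have s: "?n - t \<in> {1..2 * k}" "?n - (?n - t) = t" and "b (?n - t)"
        using b'[of t] by auto
      then show "?n - t \<in> ?V"
        using step[OF s(1)] t by simp
    qed
    show "(\<lambda>t. ?n - t) \<in> ?V \<rightarrow> ?R"
    proof
      fix s assume s: "s \<in> ?V"
      then have t: "?n - s \<in> {1..2 * k}" "?n - (?n - s) = s"
        by auto
      then show "?n - s \<in> ?R"
        using s step[of s] b'[OF t(1)] by simp
    qed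
  qed auto
  \<comment> \<open>The correction term of \<open>horizontal_steps_below_eq\<close> vanishes because
    the path ends on the diagonal.\<close>
  also have "\<dots> = card {t \<in> {1..2 * k}. \<not> b t \<and> Y t \<le> X t}"
    using horizontal_steps_below_eq[where b = b and m = "2 * k"] diag
    unfolding X[symmetric] Y[symmetric] by simp
  also have "\<dots> = lex_color k A i"
    unfolding lex_color_def b_def X_def Y_def by (rule refl)
  finally show ?thesis .
qed

section \<open>The coloring of the middle-levels graph\<close>

lemma middle_graph_simps [simp]:
  "verts (middle_graph k) = level (2 * k + 1) k \<union> level (2 * k + 1) (k + 1)"
  "ends (middle_graph k) e = e"
  by (simp_all add: middle_graph_def Let_def)

text \<open>The two levels are consecutive, so a single element of the upper set outside the lower
  one completes it. This provides the pair (A, i) from which colors are computed.\<close>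

lemma middle_edge_iff:
  "e \<in> edges (middle_graph k) \<longleftrightarrow>
    (\<exists>A \<in> level (2 * k + 1) k. \<exists>i \<in> {..<2 * k + 1} - A. e = {A, insert i A})"
proof
  assume "e \<in> edges (middle_graph k)"
  then obtain A B where AB: "e = {A, B}" "A \<in> level (2 * k + 1) k"
      "B \<in> level (2 * k + 1) (k + 1)" "A \<subset> B"
    by (auto simp: middle_graph_def Let_def)
  then obtain i where i: "i \<in> B" "i \<notin> A"
    by auto
  have "finite B"
    using AB(3) by (auto simp: level_def intro: finite_subset)
  then have "insert i A = B"
    using AB i finite_subset[of A B]
    by (intro card_subset_eq) (auto simp: level_def)
  moreover have "i \<in> {..<2 * k + 1} - A"
    using AB(3) i by (auto simp: level_def)
  ultimately show "\<exists>A \<in> level (2 * k + 1) k. \<exists>i \<in> {..<2 * k + 1} - A. e = {A, insert i A}"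
    using AB(1,2) by blast
next
  assume "\<exists>A \<in> level (2 * k + 1) k. \<exists>i \<in> {..<2 * k + 1} - A. e = {A, insert i A}"
  then obtain A i where A: "A \<in> level (2 * k + 1) k" "i \<in> {..<2 * k + 1} - A" "e = {A, insert i A}"
    by auto
  have "insert i A \<in> level (2 * k + 1) (k + 1)"
    using A by (auto simp: level_def card_insert_if finite_subset)
  moreover have "A \<subset> insert i A"
    using A(2) by auto
  ultimately show "e \<in> edges (middle_graph k)"
    using A(1,3) unfolding middle_graph_def Let_def by auto
qed

lemma translate_middle_edge:
  assumes "e \<in> edges (middle_graph k)"
  shows "translate (2 * k + 1) s ` e \<in> edges (middle_graph k)"
    and "edge_color k (translate (2 * k + 1) s ` e) = edge_color k e"
proof -
  let ?T = "translate (2 * k + 1) s"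
  obtain A i where e: "A \<in> level (2 * k + 1) k" "i \<in> {..<2 * k + 1} - A" "e = {A, insert i A}"
    using assms by (auto simp: middle_edge_iff)
  have A: "A \<subseteq> {..<2 * k + 1}"
    using e(1) by (simp add: level_def)
  let ?i = "(i + s) mod (2 * k + 1)"
  have *: "?T A \<in> level (2 * k + 1) k" "?i \<in> {..<2 * k + 1} - ?T A"
      "?T ` e = {?T A, insert ?i (?T A)}"
    using e translate_level[OF e(1)] translate_mem_iff[OF A, of i s] by (auto simp: translate_insert)
  then show "?T ` e \<in> edges (middle_graph k)"
    unfolding middle_edge_iff by blast
  have "edge_color k (?T ` e) = lex_color k (?T A) ?i"
    unfolding *(3) by (rule edge_color_eq[OF *(1,2)])
  also have "\<dots> = lex_color k A i"
    by (rule lex_color_translate[OF A])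
  also have "\<dots> = edge_color k e"
    unfolding e(3) by (rule edge_color_eq[OF e(1,2), symmetric])
  finally show "edge_color k (?T ` e) = edge_color k e" .
qed

text \<open>Complementation reverses inclusion, so the image of the upper end becomes the lower end,
  and the added element becomes its mirror image.\<close>

lemma aleph_edge_props:
  assumes "A \<in> level (2 * k + 1) k" "i \<in> {..<2 * k + 1} - A"
  shows "aleph (2 * k + 1) (insert i A) \<in> level (2 * k + 1) k"
    and "2 * k - i \<in> {..<2 * k + 1} - aleph (2 * k + 1) (insert i A)"
    and "aleph (2 * k + 1) A = insert (2 * k - i) (aleph (2 * k + 1) (insert i A))"
proof -
  have "insert i A \<in> level (2 * k + 1) (k + 1)"
    using assms by (auto simp: level_def card_insert_if finite_subset)
  from aleph_level[OF this] show "aleph (2 * k + 1) (insert i A) \<in> level (2 * k + 1) k"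
    by simp
  show "2 * k - i \<in> {..<2 * k + 1} - aleph (2 * k + 1) (insert i A)"
    using assms by (auto simp: aleph_def)
  show "aleph (2 * k + 1) A = insert (2 * k - i) (aleph (2 * k + 1) (insert i A))"
    using assms aleph_eq_insert[of i "2 * k + 1" A] by simp
qed

lemma edge_color_aleph:
  assumes "A \<in> level (2 * k + 1) k" "i \<in> {..<2 * k + 1} - A"
  shows "edge_color k {aleph (2 * k + 1) (insert i A), aleph (2 * k + 1) A} =
    edge_color k {A, insert i A}"
  unfolding aleph_edge_props(3)[OF assms] edge_color_eq[OF aleph_edge_props(1,2)[OF assms]]
    edge_color_eq[OF assms] by (rule lex_color_aleph[OF assms])

lemma aleph_middle_edge:
  assumes "e \<in> edges (middle_graph k)"
  shows "aleph (2 * k + 1) ` e \<in> edges (middle_graph k)"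
    and "edge_color k (aleph (2 * k + 1) ` e) = edge_color k e"
proof -
  obtain A i where e: "A \<in> level (2 * k + 1) k" "i \<in> {..<2 * k + 1} - A" "e = {A, insert i A}"
    using assms by (auto simp: middle_edge_iff)
  have *: "aleph (2 * k + 1) ` e = {aleph (2 * k + 1) (insert i A), aleph (2 * k + 1) A}"
    using e(3) by auto
  show "aleph (2 * k + 1) ` e \<in> edges (middle_graph k)"
    using aleph_edge_props[OF e(1,2)] unfolding * middle_edge_iff by blast
  show "edge_color k (aleph (2 * k + 1) ` e) = edge_color k e"
    unfolding * using edge_color_aleph[OF e(1,2)] e(3) by simp
qed

lemma middle_edge_subset: "e \<in> edges (middle_graph k) \<Longrightarrow> A \<in> e \<Longrightarrow> A \<subseteq> {..<2 * k + 1}"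
  by (auto simp: middle_edge_iff level_def)

lemma aleph_aleph_middle_edge:
  "e \<in> edges (middle_graph k) \<Longrightarrow> aleph (2 * k + 1) ` aleph (2 * k + 1) ` e = e"
  using middle_edge_subset by (force simp: image_image aleph_aleph)

text \<open>The edges at \<open>A\<close> correspond to the zeros of \<open>A\<close>, on which the
  color is a bijection onto 0, ..., k.\<close>

lemma ex1_middle_edge_lower:
  assumes "A \<in> level (2 * k + 1) k" "j \<le> k"
  shows "\<exists>!e. e \<in> edges (middle_graph k) \<and> A \<in> e \<and> edge_color k e = j"
proof -
  note bij = bij_betw_lex_color[OF assms(1)]
  have "j \<in> lex_color k A ` ({..<2 * k + 1} - A)"
    using bij_betw_imp_surj_on[OF bij] assms(2) by simp
  then obtain i where i: "i \<in> {..<2 * k + 1} - A" "lex_color k A i = j"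
    by blast
  have uniq: "i' = i" if "i' \<in> {..<2 * k + 1} - A" "lex_color k A i' = j" for i'
    using inj_onD[OF bij_betw_imp_inj_on[OF bij] _ that(1) i(1)] that(2) i(2) by simp
  show ?thesis
  proof (intro ex1I conjI)
    show "{A, insert i A} \<in> edges (middle_graph k)"
      unfolding middle_edge_iff using assms(1) i(1) by blast
    show "edge_color k {A, insert i A} = j"
      using edge_color_eq[OF assms(1) i(1)] i(2) by simp
  next
    fix e assume e: "e \<in> edges (middle_graph k) \<and> A \<in> e \<and> edge_color k e = j"
    then obtain A' i' where e': "A' \<in> level (2 * k + 1) k" "i' \<in> {..<2 * k + 1} - A'"
        "e = {A', insert i' A'}"
      by (auto simp: middle_edge_iff)
    \<comment> \<open>By cardinality, a vertex of the lower level cannot be the upper end of an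
      edge.\<close>
    have "A = A'"
    proof (rule ccontr)
      assume "A \<noteq> A'"
      then have "A = insert i' A'"
        using e e'(3) by blast
      then have "card A = Suc (card A')"
        using e'(1,2) by (auto simp: level_def card_insert_if finite_subset)
      then show False
        using assms(1) e'(1) by (simp add: level_def)
    qed
    then show "e = {A, insert i A}"
      using uniq[of i'] e' e edge_color_eq[OF e'(1,2)] by simp
  qed simp
qed

text \<open>\<open>aleph\<close> is a color-preserving involution on the edges that exchanges the
  levels, so an upper vertex inherits the claim from its image.\<close>

lemma ex1_middle_edge:
  assumes "v \<in> verts (middle_graph k)" "j \<le> k"
  shows "\<exists>!e. e \<in> edges (middle_graph k) \<and> v \<in> e \<and> edge_color k e = j"
proof (cases "v \<in> level (2 * k + 1) k")
  case True
  then show ?thesis by (rule ex1_middle_edge_lower[OF _ assms(2)])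
next
  case False
  let ?a = "aleph (2 * k + 1)"
  have v: "v \<in> level (2 * k + 1) (k + 1)"
    using assms(1) False by simp
  then have "?a (?a v) = v" "?a v \<in> level (2 * k + 1) k"
    using aleph_level[OF v] by (auto simp: aleph_aleph level_def)
  then obtain e where e: "e \<in> edges (middle_graph k)" "?a v \<in> e" "edge_color k e = j"
    and uniq: "\<And>e'. e' \<in> edges (middle_graph k) \<Longrightarrow> ?a v \<in> e' \<Longrightarrow> edge_color k e' = j \<Longrightarrow> e' = e"
    using ex1_middle_edge_lower[OF _ assms(2)] by blast
  show ?thesis
  proof (rule ex1I[of _ "?a ` e"])
    show "?a ` e \<in> edges (middle_graph k) \<and> v \<in> ?a ` e \<and> edge_color k (?a ` e) = j"
      using aleph_middle_edge[OF e(1)] e \<open>?a (?a v) = v\<close> by (metis imageI)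
  next
    fix f assume f: "f \<in> edges (middle_graph k) \<and> v \<in> f \<and> edge_color k f = j"
    then have "?a ` f = e"
      using aleph_middle_edge[of f k] by (intro uniq) (simp_all only: imageI)
    then show "f = ?a ` e"
      using aleph_aleph_middle_edge[of f k] f by simp
  qed
qed

text \<open>Shared by all three graphs. A partition has no empty block, so some vertex must exist to
  witness each color.\<close>

lemma one_factorization_color_classes:
  assumes "verts G \<noteq> {}"
    and ex1: "\<And>v j. v \<in> verts G \<Longrightarrow> j \<le> k \<Longrightarrow> \<exists>!e. e \<in> edges G \<and> v \<in> ends G e \<and> c e = j"
    and le: "\<And>e. e \<in> edges G \<Longrightarrow> c e \<le> k"
  shows "one_factorization G (color_class G c ` {0..k})"
  unfolding one_factorization_def
proof (intro conjI ballI)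
  have "color_class G c j \<noteq> {}" if "j \<le> k" for j
    using ex1[OF _ that] assms(1) by (fastforce simp: color_class_def)
  then have "{} \<notin> color_class G c ` {0..k}"
    by (metis atLeastAtMost_iff imageE)
  moreover have "\<Union> (color_class G c ` {0..k}) = edges G" "disjoint (color_class G c ` {0..k})"
    using le by (auto simp: disjoint_def color_class_def)
  ultimately show "partition_on (edges G) (color_class G c ` {0..k})"
    by (simp add: partition_on_def)
next
  fix F assume "F \<in> color_class G c ` {0..k}"
  then obtain j where "j \<le> k" "F = color_class G c j"
    by auto
  then show "one_factor G F"
    using ex1 by (auto simp: one_factor_def color_class_def conj_ac)
qed

lemma edge_color_le:
  assumes "e \<in> edges (middle_graph k)"
  shows "edge_color k e \<le> k"
proof -
  obtain A i where e: "A \<in> level (2 * k + 1) k" "i \<in> {..<2 * k + 1} - A" "e = {A, insert i A}"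
    using assms by (auto simp: middle_edge_iff)
  have "lex_color k A i \<in> {0..k}"
    by (rule bij_betw_apply[OF bij_betw_lex_color[OF e(1)] e(2)])
  then show ?thesis
    unfolding e(3) edge_color_eq[OF e(1,2)] by simp
qed

lemma level_middle_nonempty: "level (2 * k + 1) k \<noteq> {}"
proof -
  have "{..<k} \<in> level (2 * k + 1) k"
    by (auto simp: level_def)
  then show ?thesis by blast
qed

lemma level_subset: "A \<in> level n j \<Longrightarrow> A \<subseteq> {..<n}"
  by (simp add: level_def)

section \<open>The quotient graph\<close>

lemma self_mem_vertex_orbit: "A \<subseteq> {..<n} \<Longrightarrow> A \<in> vertex_orbit n A"
  using translate_mult_self[of A n 0] unfolding vertex_orbit_def by (metis rangeI)

lemma vertex_orbit_translate:
  assumes "A \<subseteq> {..<n}"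
  shows "vertex_orbit n (translate n s A) = vertex_orbit n A"
proof
  show "vertex_orbit n (translate n s A) \<subseteq> vertex_orbit n A"
    by (auto simp: vertex_orbit_def translate_translate)
  have "translate n t A = translate n ((n - 1) * s + t) (translate n s A)" for t
    using translate_inverse[OF assms, of s] translate_translate[of n t "(n - 1) * s" "translate n s A"]
    by simp
  then show "vertex_orbit n A \<subseteq> vertex_orbit n (translate n s A)"
    unfolding vertex_orbit_def by blast
qed

lemma middle_edge_subset_Pow: "e \<in> edges (middle_graph k) \<Longrightarrow> e \<subseteq> Pow {..<2 * k + 1}"
  using middle_edge_subset by blast

lemma self_mem_edge_orbit:
  assumes "e \<subseteq> Pow {..<n}"
  shows "e \<in> edge_orbit n e"
proof -
  have "translate n 0 ` e = (\<lambda>A. A) ` e"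
    using assms translate_mult_self[of _ n 0] by (intro image_cong) auto
  then show ?thesis
    unfolding edge_orbit_def by (metis image_ident rangeI)
qed

lemma edge_orbit_translate:
  assumes "e \<subseteq> Pow {..<n}"
  shows "edge_orbit n (image (translate n s) e) = edge_orbit n e"
proof
  have "translate n t ` translate n s ` e = translate n (s + t) ` e" for t
    by (simp add: image_image translate_translate)
  then show "edge_orbit n (image (translate n s) e) \<subseteq> edge_orbit n e"
    unfolding edge_orbit_def by blast
  have "translate n t ` e = translate n ((n - 1) * s + t) ` translate n s ` e" for t
    unfolding image_image
  proof (rule image_cong)
    fix A assume "A \<in> e"
    then have "A \<subseteq> {..<n}"
      using assms by blast
    from translate_inverse[OF this, of s]
    show "translate n t A = translate n ((n - 1) * s + t) (translate n s A)"
      using translate_translate[of n t "(n - 1) * s" "translate n s A"] by simp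
  qed simp
  then show "edge_orbit n e \<subseteq> edge_orbit n (image (translate n s) e)"
    unfolding edge_orbit_def by blast
qed

section \<open>The action of \<open>aleph\<close> on orbits\<close>

text \<open>The counterpart of \<open>aleph_translate\<close> with the shift outside; the two
  together give both inclusions when \<open>aleph\<close> is applied to an orbit.\<close>

lemma translate_aleph:
  assumes "A \<subseteq> {..<n}"
  shows "translate n s (aleph n A) = aleph n (translate n ((n - 1) * s) A)"
proof -
  have "aleph n (translate n s (aleph n A)) = translate n ((n - 1) * s) A"
    using aleph_translate[OF aleph_subset, of n s A] aleph_aleph[OF assms] by simp
  then show ?thesis
    using aleph_aleph[OF translate_subset[OF aleph_subset], of n s A] by simp
qed

lemma aleph_orbit_vertex_orbit:
  assumes "A \<subseteq> {..<n}"
  shows "aleph_orbit n (vertex_orbit n A) = vertex_orbit n (aleph n A)"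
  using aleph_translate[OF assms] translate_aleph[OF assms]
  unfolding aleph_orbit_def vertex_orbit_def by blast

text \<open>The action induced on quotient edges. Such an edge is a set of edges, which are sets of
  vertices, hence the two nested images.\<close>

definition aleph_edges :: "nat \<Rightarrow> nat set set set \<Rightarrow> nat set set set" where
  "aleph_edges n E = image (aleph n) ` E"

lemma aleph_edges_edge_orbit:
  assumes "e \<subseteq> Pow {..<n}"
  shows "aleph_edges n (edge_orbit n e) = edge_orbit n (image (aleph n) e)"
proof -
  have fwd: "aleph n ` translate n s ` e = translate n ((n - 1) * s) ` aleph n ` e"
    and bwd: "translate n s ` aleph n ` e = aleph n ` translate n ((n - 1) * s) ` e" for s
    unfolding image_image using assms aleph_translate[of _ n s] translate_aleph[of _ n s]
    by (auto intro!: image_cong)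
  show ?thesis
  proof (intro equalityI subsetI)
    fix f assume "f \<in> aleph_edges n (edge_orbit n e)"
    then obtain s where "f = aleph n ` translate n s ` e"
      unfolding aleph_edges_def edge_orbit_def by blast
    then show "f \<in> edge_orbit n (image (aleph n) e)"
      unfolding fwd edge_orbit_def by (rule range_eqI)
  next
    fix f assume "f \<in> edge_orbit n (image (aleph n) e)"
    then obtain s where "f = translate n s ` aleph n ` e"
      unfolding edge_orbit_def by blast
    then show "f \<in> aleph_edges n (edge_orbit n e)"
      unfolding bwd aleph_edges_def edge_orbit_def by (intro image_eqI[OF _ rangeI])
  qed
qed

lemma quotient_graph_simps [simp]:
  "verts (quotient_graph k) = level_quotient (2 * k + 1) k \<union> level_quotient (2 * k + 1) (k + 1)"
  "edges (quotient_graph k) = edge_orbit (2 * k + 1) ` edges (middle_graph k)"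
  by (simp_all add: quotient_graph_def Let_def)

text \<open>The endpoints are defined from the whole orbit, but translates of \<open>e\<close>
  contribute no new vertex orbits.\<close>

lemma ends_edge_orbit:
  assumes "e \<in> edges (middle_graph k)"
  shows "ends (quotient_graph k) (edge_orbit (2 * k + 1) e) = vertex_orbit (2 * k + 1) ` e"
proof
  let ?n = "2 * k + 1"
  have ends: "ends (quotient_graph k) E = vertex_orbit ?n ` \<Union> E" for E
    by (simp add: quotient_graph_def Let_def)
  show "vertex_orbit ?n ` e \<subseteq> ends (quotient_graph k) (edge_orbit ?n e)"
    using self_mem_edge_orbit[OF middle_edge_subset_Pow[OF assms]] unfolding ends by blast
  have "vertex_orbit ?n (translate ?n s A) \<in> vertex_orbit ?n ` e" if "A \<in> e" for A s
    using vertex_orbit_translate[OF middle_edge_subset[OF assms that]] that by simp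
  then show "ends (quotient_graph k) (edge_orbit ?n e) \<subseteq> vertex_orbit ?n ` e"
    unfolding ends edge_orbit_def by blast
qed

lemma induced_color_eq:
  assumes "x \<in> S" and "\<And>y. y \<in> S \<Longrightarrow> c y = c x"
  shows "induced_color c S = c x"
  unfolding induced_color_def
proof (rule the_equality)
  show "\<forall>e \<in> S. c e = c x"
    using assms(2) by blast
  show "j = c x" if "\<forall>e \<in> S. c e = j" for j
    using that assms(1) by simp
qed

lemma quotient_color_edge_orbit:
  assumes "e \<in> edges (middle_graph k)"
  shows "quotient_color k (edge_orbit (2 * k + 1) e) = edge_color k e"
  unfolding quotient_color_def
proof (rule induced_color_eq)
  show "e \<in> edge_orbit (2 * k + 1) e"
    by (rule self_mem_edge_orbit[OF middle_edge_subset_Pow[OF assms]])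
  show "edge_color k f = edge_color k e" if "f \<in> edge_orbit (2 * k + 1) e" for f
    using that translate_middle_edge(2)[OF assms] by (auto simp: edge_orbit_def)
qed

lemma ex1_quotient_edge:
  assumes "v \<in> verts (quotient_graph k)" "j \<le> k"
  shows "\<exists>!E. E \<in> edges (quotient_graph k) \<and> v \<in> ends (quotient_graph k) E \<and> quotient_color k E = j"
proof -
  let ?n = "2 * k + 1"
  obtain A where A: "A \<in> verts (middle_graph k)" "v = vertex_orbit ?n A"
    using assms(1) by (auto simp: level_quotient_def)
  obtain e where e: "e \<in> edges (middle_graph k)" "A \<in> e" "edge_color k e = j"
    and uniq: "\<And>f. f \<in> edges (middle_graph k) \<Longrightarrow> A \<in> f \<Longrightarrow> edge_color k f = j \<Longrightarrow> f = e"
    using ex1_middle_edge[OF A(1) assms(2)] by blast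
  show ?thesis
  proof (intro ex1I conjI)
    show "edge_orbit ?n e \<in> edges (quotient_graph k)"
      using e(1) by simp
    show "v \<in> ends (quotient_graph k) (edge_orbit ?n e)"
      unfolding ends_edge_orbit[OF e(1)] A(2) using e(2) by (rule imageI)
    show "quotient_color k (edge_orbit ?n e) = j"
      unfolding quotient_color_edge_orbit[OF e(1)] by (rule e(3))
  next
    fix E
    assume E: "E \<in> edges (quotient_graph k) \<and> v \<in> ends (quotient_graph k) E \<and> quotient_color k E = j"
    then obtain f where f: "f \<in> edges (middle_graph k)" "E = edge_orbit ?n f"
      by auto
    then have "v \<in> vertex_orbit ?n ` f" "edge_color k f = j"
      using E ends_edge_orbit[OF f(1)] quotient_color_edge_orbit[OF f(1)] by simp_all
    then obtain B where B: "B \<in> f" "v = vertex_orbit ?n B"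
      by auto
    \<comment> \<open>The representative \<open>f\<close> meets the orbit \<open>v\<close> in
      \<open>B\<close>, perhaps not in \<open>A\<close>. Translating \<open>B\<close> to
      \<open>A\<close> moves \<open>f\<close> to an edge at \<open>A\<close> of the same color,
      which must be \<open>e\<close>.\<close>
    have "A \<in> vertex_orbit ?n B"
      using self_mem_vertex_orbit[OF middle_edge_subset[OF e(1,2)]] A(2) B(2) by simp
    then obtain s where s: "A = translate ?n s B"
      by (auto simp: vertex_orbit_def)
    have "translate ?n s ` f = e"
    proof (rule uniq)
      show "A \<in> translate ?n s ` f"
        unfolding s using B(1) by (rule imageI)
      show "edge_color k (translate ?n s ` f) = j"
        unfolding translate_middle_edge(2)[OF f(1)] by fact
    qed (rule translate_middle_edge(1)[OF f(1)])
    then show "E = edge_orbit ?n e"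
      using edge_orbit_translate[OF middle_edge_subset_Pow[OF f(1)], where s = s] f(2) by simp
  qed
qed

lemma quotient_color_le: "E \<in> edges (quotient_graph k) \<Longrightarrow> quotient_color k E \<le> k"
  using quotient_color_edge_orbit edge_color_le by auto

section \<open>Levels, \<open>aleph\<close> and the two kinds of quotient edges\<close>

lemma card_of_mem_level_quotient: "u \<in> level_quotient n j \<Longrightarrow> A \<in> u \<Longrightarrow> card A = j"
  using translate_level by (fastforce simp: level_quotient_def vertex_orbit_def level_def)

lemma level_quotient_disjoint:
  assumes "u \<in> level_quotient n i" "u \<in> level_quotient n j"
  shows "i = j"
proof -
  obtain A where "A \<in> u"
    using assms(1) by (auto simp: level_quotient_def vertex_orbit_def)
  then show ?thesis
    using card_of_mem_level_quotient[OF assms(1)] card_of_mem_level_quotient[OF assms(2)] by simp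
qed

lemma aleph_orbit_level_quotient:
  assumes "u \<in> level_quotient n j"
  shows "aleph_orbit n u \<in> level_quotient n (n - j)" and "aleph_orbit n (aleph_orbit n u) = u"
proof -
  obtain A where A: "A \<in> level n j" "u = vertex_orbit n A"
    using assms by (auto simp: level_quotient_def)
  then have "aleph_orbit n u = vertex_orbit n (aleph n A)"
    using aleph_orbit_vertex_orbit[OF level_subset] by simp
  then show "aleph_orbit n u \<in> level_quotient n (n - j)"
    and "aleph_orbit n (aleph_orbit n u) = u"
    using aleph_level[OF A(1)] aleph_aleph[OF level_subset[OF A(1)]] A(2)
    by (simp_all add: level_quotient_def aleph_orbit_vertex_orbit[OF aleph_subset])
qed

text \<open>\<open>aleph_edges\<close> is a color-preserving involutive automorphism of the quotient
  graph; each property is read off from a representative \<open>e\<close>.\<close>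

lemma aleph_edges_quotient:
  assumes "E \<in> edges (quotient_graph k)"
  shows "aleph_edges (2 * k + 1) E \<in> edges (quotient_graph k)"
    and "aleph_edges (2 * k + 1) (aleph_edges (2 * k + 1) E) = E"
    and "ends (quotient_graph k) (aleph_edges (2 * k + 1) E) =
      aleph_orbit (2 * k + 1) ` ends (quotient_graph k) E"
    and "quotient_color k (aleph_edges (2 * k + 1) E) = quotient_color k E"
proof -
  let ?n = "2 * k + 1"
  obtain e where e: "e \<in> edges (middle_graph k)" and E: "E = edge_orbit ?n e"
    using assms by auto
  note ae = aleph_middle_edge[OF e]
  have aE: "aleph_edges ?n E = edge_orbit ?n (aleph ?n ` e)"
    unfolding E by (rule aleph_edges_edge_orbit[OF middle_edge_subset_Pow[OF e]])
  show "aleph_edges ?n E \<in> edges (quotient_graph k)"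
    unfolding aE using ae(1) by simp
  show "aleph_edges ?n (aleph_edges ?n E) = E"
    unfolding aE aleph_edges_edge_orbit[OF middle_edge_subset_Pow[OF ae(1)]] aleph_aleph_middle_edge[OF e]
    unfolding E by (rule refl)
  show "ends (quotient_graph k) (aleph_edges ?n E) = aleph_orbit ?n ` ends (quotient_graph k) E"
    unfolding aE ends_edge_orbit[OF ae(1)] unfolding E ends_edge_orbit[OF e] image_image
    by (rule image_cong[OF refl])
      (rule aleph_orbit_vertex_orbit[OF middle_edge_subset[OF e], symmetric])
  show "quotient_color k (aleph_edges ?n E) = quotient_color k E"
    unfolding aE quotient_color_edge_orbit[OF ae(1)] ae(2)
    unfolding E quotient_color_edge_orbit[OF e] by (rule refl)
qed

lemma quotient_edge_cases:
  assumes "E \<in> edges (quotient_graph k)"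
  obtains u w where "u \<in> level_quotient (2 * k + 1) k" "w \<in> level_quotient (2 * k + 1) (k + 1)"
    "ends (quotient_graph k) E = {u, w}"
    "E \<in> skew_edges k \<longleftrightarrow> w \<noteq> aleph_orbit (2 * k + 1) u"
    "E \<in> horizontal_edges k \<longleftrightarrow> w = aleph_orbit (2 * k + 1) u"
proof -
  let ?n = "2 * k + 1"
  obtain e where e: "e \<in> edges (middle_graph k)" "E = edge_orbit ?n e"
    using assms by auto
  obtain A i where A: "A \<in> level ?n k" "i \<in> {..<?n} - A" "e = {A, insert i A}"
    using e(1) by (auto simp: middle_edge_iff)
  define u w where "u = vertex_orbit ?n A" and "w = vertex_orbit ?n (insert i A)"
  have "insert i A \<in> level ?n (k + 1)"
    using A by (auto simp: level_def card_insert_if finite_subset)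
  then have uw: "u \<in> level_quotient ?n k" "w \<in> level_quotient ?n (k + 1)"
    using A(1) by (simp_all add: level_quotient_def u_def w_def)
  have ends: "ends (quotient_graph k) E = {u, w}"
    unfolding e(2) ends_edge_orbit[OF e(1)] unfolding A(3) u_def w_def by simp
  \<comment> \<open>The levels of the quotient are disjoint, so the two ends cannot be interchanged.
    The existential conditions for skew and horizontal edges thus become conditions on this one
    pair.\<close>
  have unique: "u' = u \<and> w' = w"
    if "u' \<in> level_quotient ?n k" "w' \<in> level_quotient ?n (k + 1)" "{u, w} = {u', w'}" for u' w'
    using that level_quotient_disjoint[of u ?n k "k + 1"] uw by (auto simp: doubleton_eq_iff)
  have "E \<in> skew_edges k \<longleftrightarrow> w \<noteq> aleph_orbit ?n u"
  proof
    assume "E \<in> skew_edges k"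
    then obtain u' w' where "u' \<in> level_quotient ?n k" "w' \<in> level_quotient ?n (k + 1)"
      "{u, w} = {u', w'}" "w' \<noteq> aleph_orbit ?n u'"
      unfolding skew_edges_def Let_def mem_Collect_eq ends by (elim conjE bexE)
    then show "w \<noteq> aleph_orbit ?n u"
      using unique by metis
  next
    assume neq: "w \<noteq> aleph_orbit ?n u"
    show "E \<in> skew_edges k"
      unfolding skew_edges_def Let_def mem_Collect_eq
      by (rule conjI[OF assms], rule rev_bexI[OF uw(1)], rule rev_bexI[OF uw(2)], rule conjI[OF ends neq])
  qed
  moreover have "E \<in> horizontal_edges k \<longleftrightarrow> w = aleph_orbit ?n u"
  proof
    assume "E \<in> horizontal_edges k"
    then obtain u' where u': "u' \<in> level_quotient ?n k" "{u, w} = {u', aleph_orbit ?n u'}"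
      unfolding horizontal_edges_def Let_def mem_Collect_eq ends by (elim conjE bexE)
    moreover have "aleph_orbit ?n u' \<in> level_quotient ?n (k + 1)"
      using aleph_orbit_level_quotient(1)[OF u'(1)] by simp
    ultimately show "w = aleph_orbit ?n u"
      using unique by metis
  next
    assume "w = aleph_orbit ?n u"
    with ends have "ends (quotient_graph k) E = {u, aleph_orbit ?n u}"
      by simp
    then show "E \<in> horizontal_edges k"
      unfolding horizontal_edges_def Let_def mem_Collect_eq
      by (intro conjI[OF assms] rev_bexI[OF uw(1)])
  qed
  ultimately show ?thesis
    using that uw ends by blast
qed

lemma not_skew_iff_horizontal:
  "E \<in> edges (quotient_graph k) \<Longrightarrow> E \<notin> skew_edges k \<longleftrightarrow> E \<in> horizontal_edges k"
  by (erule quotient_edge_cases) simp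

lemma special_edge_subset:
  "E \<in> skew_edges k \<Longrightarrow> E \<in> edges (quotient_graph k)"
  "E \<in> horizontal_edges k \<Longrightarrow> E \<in> edges (quotient_graph k)"
  by (simp_all add: skew_edges_def horizontal_edges_def Let_def)

lemma aleph_edges_skew:
  assumes "E \<in> skew_edges k"
  shows "aleph_edges (2 * k + 1) E \<in> skew_edges k"
proof -
  let ?n = "2 * k + 1"
  have E: "E \<in> edges (quotient_graph k)"
    by (rule special_edge_subset(1)[OF assms])
  obtain u w where uw: "u \<in> level_quotient ?n k" "w \<in> level_quotient ?n (k + 1)"
    "ends (quotient_graph k) E = {u, w}" "w \<noteq> aleph_orbit ?n u"
    using quotient_edge_cases[OF E] assms by metis
  have "aleph_orbit ?n w \<in> level_quotient ?n k" "aleph_orbit ?n u \<in> level_quotient ?n (k + 1)"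
    using aleph_orbit_level_quotient(1)[OF uw(1)] aleph_orbit_level_quotient(1)[OF uw(2)] by simp_all
  moreover have "ends (quotient_graph k) (aleph_edges ?n E) = {aleph_orbit ?n w, aleph_orbit ?n u}"
    unfolding aleph_edges_quotient(3)[OF E] uw(3) by auto
  moreover have "aleph_orbit ?n u \<noteq> aleph_orbit ?n (aleph_orbit ?n w)"
    using uw(4) aleph_orbit_level_quotient(2)[OF uw(2)] by simp
  ultimately show ?thesis
    unfolding skew_edges_def Let_def using aleph_edges_quotient(1)[OF E] by blast
qed

lemma aleph_edges_horizontal:
  assumes "E \<in> horizontal_edges k"
  shows "aleph_edges (2 * k + 1) E = E"
proof -
  let ?n = "2 * k + 1"
  have E: "E \<in> edges (quotient_graph k)"
    by (rule special_edge_subset(2)[OF assms])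
  obtain u w where uw: "u \<in> level_quotient ?n k" "w \<in> level_quotient ?n (k + 1)"
    "ends (quotient_graph k) E = {u, w}" "w = aleph_orbit ?n u"
    using quotient_edge_cases[OF E] assms by metis
  \<comment> \<open>Since \<open>w\<close> is the image of \<open>u\<close>, \<open>u\<close> is the
    image of \<open>w\<close>. Both \<open>E\<close> and its image are then edges at
    \<open>u\<close> of the same color, hence equal.\<close>
  have "u \<in> aleph_orbit ?n ` ends (quotient_graph k) E"
    using uw(3,4) aleph_orbit_level_quotient(2)[OF uw(1)] by auto
  moreover have "u \<in> verts (quotient_graph k)"
    using uw(1) by simp
  ultimately show ?thesis
    using ex1_quotient_edge[OF _ quotient_color_le[OF E], of u] aleph_edges_quotient[OF E] E uw(3)
    by (metis insertI1)
qed

lemma aleph_edges_skew_pair: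
  assumes "A \<in> level (2 * k + 1) k" "i \<in> {..<2 * k + 1} - A"
  shows "edge_orbit (2 * k + 1) {aleph (2 * k + 1) (insert i A), aleph (2 * k + 1) A} =
    aleph_edges (2 * k + 1) (edge_orbit (2 * k + 1) {A, insert i A})"
proof -
  have "{A, insert i A} \<in> edges (middle_graph k)"
    using assms middle_edge_iff by blast
  from aleph_edges_edge_orbit[OF middle_edge_subset_Pow[OF this]] show ?thesis
    by (simp add: insert_commute)
qed

text \<open>Replaces representatives (A, i) by quotient edges: the specular partner of
  \<open>E\<close> is its image under \<open>aleph_edges\<close>.\<close>

lemma skew_specular_pairs_eq:
  "skew_specular_pairs k = (\<lambda>E. {E, aleph_edges (2 * k + 1) E}) ` skew_edges k"
proof (intro equalityI subsetI)
  fix P assume "P \<in> skew_specular_pairs k"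
  then obtain A i where A: "A \<in> level (2 * k + 1) k" "i \<in> {..<2 * k + 1} - A"
    and E: "edge_orbit (2 * k + 1) {A, insert i A} \<in> skew_edges k"
    and P: "P = {edge_orbit (2 * k + 1) {A, insert i A},
      edge_orbit (2 * k + 1) {aleph (2 * k + 1) (insert i A), aleph (2 * k + 1) A}}"
    unfolding skew_specular_pairs_def Let_def by blast
  from P[unfolded aleph_edges_skew_pair[OF A]] E
  show "P \<in> (\<lambda>E. {E, aleph_edges (2 * k + 1) E}) ` skew_edges k"
    by (rule image_eqI)
next
  fix P assume "P \<in> (\<lambda>E. {E, aleph_edges (2 * k + 1) E}) ` skew_edges k"
  then obtain E where E: "E \<in> skew_edges k" "P = {E, aleph_edges (2 * k + 1) E}"
    by blast
  then obtain e where e: "e \<in> edges (middle_graph k)" "E = edge_orbit (2 * k + 1) e"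
    using special_edge_subset(1)[OF E(1)] by auto
  then obtain A i where A: "A \<in> level (2 * k + 1) k" "i \<in> {..<2 * k + 1} - A" "e = {A, insert i A}"
    unfolding middle_edge_iff by blast
  have "P = {edge_orbit (2 * k + 1) {A, insert i A},
      edge_orbit (2 * k + 1) {aleph (2 * k + 1) (insert i A), aleph (2 * k + 1) A}}"
    unfolding E(2) e(2) A(3) aleph_edges_skew_pair[OF A(1,2)] by (rule refl)
  moreover have "edge_orbit (2 * k + 1) {A, insert i A} \<in> skew_edges k"
    using E(1) e(2) A(3) by simp
  ultimately show "P \<in> skew_specular_pairs k"
    unfolding skew_specular_pairs_def Let_def mem_Collect_eq using A(1,2) by (intro exI conjI)
qed

section \<open>The reduced graph\<close>

text \<open>The projection of quotient edges onto reduced edges, identifying exactly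
  \<open>E\<close> and its image under \<open>aleph_edges\<close>.\<close>

definition collapse :: "nat \<Rightarrow> nat set set set \<Rightarrow> nat set set set reduced_edge" where
  "collapse k E = (if E \<in> horizontal_edges k then Horizontal_Loop E
     else Skew_Pair {E, aleph_edges (2 * k + 1) E})"

text \<open>For a horizontal edge the pair degenerates to a singleton, as \<open>aleph_edges\<close>
  fixes it; so both kinds of reduced edges can be treated alike.\<close>

lemma underlying_collapse:
  "E \<in> edges (quotient_graph k) \<Longrightarrow> underlying (collapse k E) = {E, aleph_edges (2 * k + 1) E}"
  using aleph_edges_horizontal[of E k] by (simp add: collapse_def)

lemma collapse_aleph_edges:
  assumes "E \<in> edges (quotient_graph k)"
  shows "collapse k (aleph_edges (2 * k + 1) E) = collapse k E"
proof (cases "E \<in> horizontal_edges k")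
  case True
  from aleph_edges_horizontal[OF this] show ?thesis by simp
next
  case False
  then have "aleph_edges (2 * k + 1) E \<in> skew_edges k"
    using not_skew_iff_horizontal[OF assms] aleph_edges_skew by blast
  then have "aleph_edges (2 * k + 1) E \<notin> horizontal_edges k"
    using not_skew_iff_horizontal special_edge_subset(1) by blast
  then show ?thesis
    using False aleph_edges_quotient(2)[OF assms] by (simp add: collapse_def insert_commute)
qed

lemma verts_reduced_graph: "verts (reduced_graph k) = level_quotient (2 * k + 1) k"
  by (simp add: reduced_graph_def Let_def)

lemma edges_reduced_graph: "edges (reduced_graph k) = collapse k ` edges (quotient_graph k)"
proof (intro equalityI subsetI)
  fix r assume "r \<in> edges (reduced_graph k)"
  then have "r \<in> Skew_Pair ` skew_specular_pairs k \<union> Horizontal_Loop ` horizontal_edges k"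
    by (simp add: reduced_graph_def Let_def)
  then show "r \<in> collapse k ` edges (quotient_graph k)"
  proof
    assume "r \<in> Skew_Pair ` skew_specular_pairs k"
    then obtain E where E: "E \<in> skew_edges k" "r = Skew_Pair {E, aleph_edges (2 * k + 1) E}"
      unfolding skew_specular_pairs_eq by blast
    then have "r = collapse k E"
      using not_skew_iff_horizontal[OF special_edge_subset(1)[OF E(1)]] by (simp add: collapse_def)
    then show ?thesis
      using special_edge_subset(1)[OF E(1)] by (rule image_eqI)
  next
    assume "r \<in> Horizontal_Loop ` horizontal_edges k"
    then obtain E where E: "E \<in> horizontal_edges k" "r = Horizontal_Loop E"
      by blast
    then have "r = collapse k E"
      by (simp add: collapse_def)
    then show ?thesis
      using special_edge_subset(2)[OF E(1)] by (rule image_eqI)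
  qed
next
  fix r assume "r \<in> collapse k ` edges (quotient_graph k)"
  then obtain E where E: "E \<in> edges (quotient_graph k)" "r = collapse k E"
    by blast
  have "r \<in> Skew_Pair ` skew_specular_pairs k \<union> Horizontal_Loop ` horizontal_edges k"
    unfolding skew_specular_pairs_eq E(2) collapse_def using not_skew_iff_horizontal[OF E(1)] by auto
  then show "r \<in> edges (reduced_graph k)"
    by (simp add: reduced_graph_def Let_def)
qed

text \<open>Having the image of \<open>v\<close> as an end of \<open>F\<close> is the same as having
  \<open>v\<close> as an end of the image of \<open>F\<close>, and the underlying set is closed
  under \<open>aleph_edges\<close>.\<close>

lemma mem_ends_reduced_graph_iff:
  assumes "v \<in> level_quotient (2 * k + 1) k" "E \<in> edges (quotient_graph k)"
  shows "v \<in> ends (reduced_graph k) (collapse k E) \<longleftrightarrow>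
    v \<in> ends (quotient_graph k) E \<or> v \<in> ends (quotient_graph k) (aleph_edges (2 * k + 1) E)"
proof -
  let ?n = "2 * k + 1"
  let ?v = "aleph_orbit ?n v"
  have flip: "?v \<in> ends (quotient_graph k) F \<longleftrightarrow> v \<in> ends (quotient_graph k) (aleph_edges ?n F)"
    if F: "F \<in> edges (quotient_graph k)" for F
  proof
    assume "?v \<in> ends (quotient_graph k) F"
    then have "aleph_orbit ?n ?v \<in> ends (quotient_graph k) (aleph_edges ?n F)"
      unfolding aleph_edges_quotient(3)[OF F] by (rule imageI)
    then show "v \<in> ends (quotient_graph k) (aleph_edges ?n F)"
      unfolding aleph_orbit_level_quotient(2)[OF assms(1)] .
  next
    assume "v \<in> ends (quotient_graph k) (aleph_edges ?n F)"
    then have "?v \<in> ends (quotient_graph k) (aleph_edges ?n (aleph_edges ?n F))"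
      unfolding aleph_edges_quotient(3)[OF aleph_edges_quotient(1)[OF F]] by (rule imageI)
    then show "?v \<in> ends (quotient_graph k) F"
      unfolding aleph_edges_quotient(2)[OF F] .
  qed
  have "v \<in> ends (reduced_graph k) (collapse k E) \<longleftrightarrow>
      (\<exists>F \<in> {E, aleph_edges ?n E}. v \<in> ends (quotient_graph k) F \<or> ?v \<in> ends (quotient_graph k) F)"
    unfolding underlying_collapse[OF assms(2), symmetric] using assms(1)
    by (simp add: reduced_graph_def Let_def)
  then show ?thesis
    using flip[OF assms(2)] flip[OF aleph_edges_quotient(1)[OF assms(2)]]
      aleph_edges_quotient(2)[OF assms(2)] by auto
qed

lemma reduced_color_collapse:
  assumes "E \<in> edges (quotient_graph k)"
  shows "reduced_color k (collapse k E) = quotient_color k E"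
  unfolding reduced_color_def underlying_collapse[OF assms]
  using aleph_edges_quotient(4)[OF assms] by (intro induced_color_eq) auto

lemma ex1_reduced_edge:
  assumes "v \<in> verts (reduced_graph k)" "j \<le> k"
  shows "\<exists>!r. r \<in> edges (reduced_graph k) \<and> v \<in> ends (reduced_graph k) r \<and> reduced_color k r = j"
proof -
  have v: "v \<in> level_quotient (2 * k + 1) k"
    using assms(1) by (simp add: verts_reduced_graph)
  then have "v \<in> verts (quotient_graph k)"
    by simp
  from ex1_quotient_edge[OF this assms(2)]
  obtain E where E: "E \<in> edges (quotient_graph k)" "v \<in> ends (quotient_graph k) E" "quotient_color k E = j"
    and uniq: "\<And>F. F \<in> edges (quotient_graph k) \<Longrightarrow> v \<in> ends (quotient_graph k) F \<Longrightarrow>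
      quotient_color k F = j \<Longrightarrow> F = E"
    by blast
  show ?thesis
  proof (intro ex1I conjI)
    show "collapse k E \<in> edges (reduced_graph k)"
      unfolding edges_reduced_graph using E(1) by (rule imageI)
    show "v \<in> ends (reduced_graph k) (collapse k E)"
      using mem_ends_reduced_graph_iff[OF v E(1)] E(2) by blast
    show "reduced_color k (collapse k E) = j"
      unfolding reduced_color_collapse[OF E(1)] by (rule E(3))
  next
    fix r
    assume r: "r \<in> edges (reduced_graph k) \<and> v \<in> ends (reduced_graph k) r \<and> reduced_color k r = j"
    then obtain F where F: "F \<in> edges (quotient_graph k)" "r = collapse k F"
      unfolding edges_reduced_graph by blast
    have "quotient_color k F = j"
      using r reduced_color_collapse[OF F(1)] F(2) by simp
    moreover have "v \<in> ends (quotient_graph k) F \<or>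
        v \<in> ends (quotient_graph k) (aleph_edges (2 * k + 1) F)"
      using r mem_ends_reduced_graph_iff[OF v F(1)] F(2) by blast
    \<comment> \<open>Whichever of \<open>F\<close> and its image has \<open>v\<close> as an end is
      the unique edge of color \<open>j\<close> there, and \<open>collapse\<close> does not
      distinguish the two.\<close>
    ultimately have "F = E \<or> aleph_edges (2 * k + 1) F = E"
      using uniq[OF F(1)] uniq[OF aleph_edges_quotient(1)[OF F(1)]] aleph_edges_quotient(4)[OF F(1)]
      by metis
    then show "r = collapse k E"
      using collapse_aleph_edges[OF F(1)] F(2) by auto
  qed
qed

section \<open>The 1-factorizations of the three graphs\<close>

theorem theorem2:
  fixes k n :: nat
  assumes "k \<ge> 1" and "n = 2 * k + 1"
  shows
    "(\<forall>e \<in> edges (middle_graph k). \<forall>f \<in> edge_orbit n e. edge_color k f = edge_color k e) \<and>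
     (\<forall>v \<in> verts (quotient_graph k). \<forall>j \<in> {0..k}.
        \<exists>!E. E \<in> edges (quotient_graph k) \<and> v \<in> ends (quotient_graph k) E \<and>
             quotient_color k E = j) \<and>
     one_factorization (quotient_graph k)
       (color_class (quotient_graph k) (quotient_color k) ` {0..k}) \<and>

     (\<forall>v \<in> verts (middle_graph k). \<forall>j \<in> {0..k}.
        \<exists>!e. e \<in> edges (middle_graph k) \<and> v \<in> ends (middle_graph k) e \<and> edge_color k e = j) \<and>
     one_factorization (middle_graph k)
       (color_class (middle_graph k) (edge_color k) ` {0..k}) \<and>
     (\<forall>e \<in> edges (middle_graph k). quotient_color k (edge_orbit n e) = edge_color k e) \<and>

     (\<forall>A \<in> level n k. \<forall>i \<in> {..<n} - A.
        aleph n (insert i A) \<in> level n k \<and>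
        n - 1 - i \<in> {..<n} - aleph n (insert i A) \<and>
        aleph n A = insert (n - 1 - i) (aleph n (insert i A)) \<and>
        edge_color k {aleph n (insert i A), aleph n A} = edge_color k {A, insert i A}) \<and>
     (\<forall>P \<in> skew_specular_pairs k. \<forall>E \<in> P. \<forall>F \<in> P. quotient_color k E = quotient_color k F) \<and>
     (\<forall>r \<in> edges (reduced_graph k). \<forall>E \<in> underlying r.
        reduced_color k r = quotient_color k E) \<and>
     (\<forall>v \<in> verts (reduced_graph k). \<forall>j \<in> {0..k}.
        \<exists>!r. r \<in> edges (reduced_graph k) \<and> v \<in> ends (reduced_graph k) r \<and>
             reduced_color k r = j) \<and>
     one_factorization (reduced_graph k)
       (color_class (reduced_graph k) (reduced_color k) ` {0..k})"
  unfolding assms(2)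
proof (intro conjI)
  show "\<forall>e \<in> edges (middle_graph k). \<forall>f \<in> edge_orbit (2 * k + 1) e. edge_color k f = edge_color k e"
    using translate_middle_edge(2) unfolding edge_orbit_def by blast
  show "\<forall>v \<in> verts (quotient_graph k). \<forall>j \<in> {0..k}.
      \<exists>!E. E \<in> edges (quotient_graph k) \<and> v \<in> ends (quotient_graph k) E \<and> quotient_color k E = j"
    by (intro ballI ex1_quotient_edge) (simp_all only: atLeastAtMost_iff)
  show "one_factorization (quotient_graph k)
      (color_class (quotient_graph k) (quotient_color k) ` {0..k})"
  proof (rule one_factorization_color_classes)
    show "verts (quotient_graph k) \<noteq> {}"
      using level_middle_nonempty by (simp add: level_quotient_def)
  qed (fact ex1_quotient_edge quotient_color_le)+
  show "\<forall>v \<in> verts (middle_graph k). \<forall>j \<in> {0..k}.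
      \<exists>!e. e \<in> edges (middle_graph k) \<and> v \<in> ends (middle_graph k) e \<and> edge_color k e = j"
    unfolding middle_graph_simps(2)
    by (intro ballI ex1_middle_edge) (simp_all only: atLeastAtMost_iff)
  show "one_factorization (middle_graph k) (color_class (middle_graph k) (edge_color k) ` {0..k})"
  proof (rule one_factorization_color_classes)
    show "verts (middle_graph k) \<noteq> {}"
      using level_middle_nonempty by simp
  qed ((unfold middle_graph_simps(2))?, fact ex1_middle_edge edge_color_le)+
  show "\<forall>e \<in> edges (middle_graph k). quotient_color k (edge_orbit (2 * k + 1) e) = edge_color k e"
    using quotient_color_edge_orbit by blast
  show "\<forall>A \<in> level (2 * k + 1) k. \<forall>i \<in> {..<2 * k + 1} - A.
      aleph (2 * k + 1) (insert i A) \<in> level (2 * k + 1) k \<and>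
      2 * k + 1 - 1 - i \<in> {..<2 * k + 1} - aleph (2 * k + 1) (insert i A) \<and>
      aleph (2 * k + 1) A = insert (2 * k + 1 - 1 - i) (aleph (2 * k + 1) (insert i A)) \<and>
      edge_color k {aleph (2 * k + 1) (insert i A), aleph (2 * k + 1) A} = edge_color k {A, insert i A}"
    unfolding add_diff_cancel_right'
    by (intro ballI conjI aleph_edge_props edge_color_aleph)
  show "\<forall>P \<in> skew_specular_pairs k. \<forall>E \<in> P. \<forall>F \<in> P. quotient_color k E = quotient_color k F"
    unfolding skew_specular_pairs_eq
    using aleph_edges_quotient(4)[OF special_edge_subset(1)] by auto
  show "\<forall>r \<in> edges (reduced_graph k). \<forall>E \<in> underlying r. reduced_color k r = quotient_color k E"
  proof (intro ballI)
    fix r E assume "r \<in> edges (reduced_graph k)" "E \<in> underlying r"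
    then obtain F where F: "F \<in> edges (quotient_graph k)" "r = collapse k F" "E \<in> underlying (collapse k F)"
      unfolding edges_reduced_graph by blast
    then have "quotient_color k E = quotient_color k F"
      unfolding underlying_collapse[OF F(1)] using aleph_edges_quotient(4)[OF F(1)] by blast
    then show "reduced_color k r = quotient_color k E"
      unfolding F(2) reduced_color_collapse[OF F(1)] by simp
  qed
  show "\<forall>v \<in> verts (reduced_graph k). \<forall>j \<in> {0..k}.
      \<exists>!r. r \<in> edges (reduced_graph k) \<and> v \<in> ends (reduced_graph k) r \<and> reduced_color k r = j"
    by (intro ballI ex1_reduced_edge) (simp_all only: atLeastAtMost_iff)
  show "one_factorization (reduced_graph k)
      (color_class (reduced_graph k) (reduced_color k) ` {0..k})"
  proof (rule one_factorization_color_classes)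
    show "verts (reduced_graph k) \<noteq> {}"
      using level_middle_nonempty by (simp add: verts_reduced_graph level_quotient_def)
    show "reduced_color k r \<le> k" if "r \<in> edges (reduced_graph k)" for r
      using that quotient_color_le unfolding edges_reduced_graph by (auto simp only: reduced_color_collapse)
  qed (fact ex1_reduced_edge)
qed

end
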